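(* Let $n \ge 4$ be an even integer and let $T_{2n}(W)$ be the Toeplitz graph with vertex set $\{x_1,\dots,x_{2n}\}$ in which $x_i$ and $x_j$ are adjacent if and only if $|i-j|$ is odd or $|i-j| = n$. Then every resolving partition $\Sigma = \{S_1,\dots,S_k\}$ of $V(T_{2n}(W))$ satisfies $$k \ge \lceil 2\sqrt{n-1}\, \rceil.$$
   Context: $T_{2n}(W)$ is defined from $W = \{x_1, x_3, \dots, x_{2n-1}\} \cup \{x_n\}$: distinct vertices $x_i, x_j$ ($1\le i,j\le 2n$) are adjacent iff $|i-j| = t$ for some $x_t \in W$, i.e. iff $|i-j|$ is odd or equals $n$. For a connected graph $G$ with graph distance $d$, a vertex $v$ and a nonempty $S \subseteq V(G)$, put $d(v,S) = \min_{s\in S} d(v,s)$. For a partition $\Sigma = \{S_1,\dots,S_k\}$ of $V(G)$ into $k$ nonempty parts, the representation of $v$ is $r(v|\Sigma) = (d(v,S_1),\dots,d(v,S_k))$. $\Sigma$ is a resolving partition if $r(u|\Sigma) \ne r(v|\Sigma)$ for all distinct vertices $u,v$. *)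

theory Defs
  imports
    Complex_Main
    "HOL-Library.Disjoint_Sets"
    "Graph_Theory.Graph_Theory"
begin

text \<open>
  Simple graphs are symmetric loop-free pair digraphs (locale \<^locale>\<open>pair_graph\<close>): an edge
  is represented by its two orientations.  The vertex \<open>x\<^sub>i\<close> of a Toeplitz graph is represented by
  its index \<open>i\<close>.
\<close>

definition toeplitz_graph :: "nat \<Rightarrow> nat set \<Rightarrow> nat pair_pre_digraph" where
  "toeplitz_graph m W =
     \<lparr> pverts = {1..m},
       parcs = {(i, j). i \<in> {1..m} \<and> j \<in> {1..m} \<and> i \<noteq> j \<and>
                        (\<exists>t\<in>W. \<bar>int i - int j\<bar> = int t)} \<rparr>"

definition W_set :: "nat \<Rightarrow> nat set" where
  "W_set n = {2 * i - 1 | i. i \<in> {1..n}} \<union> {n}"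

text \<open>
  The graph distance is the least number of arcs on a walk; the library's least-cost function
  with unit costs is extended-real valued, being infinite exactly for unreachable vertices.
\<close>

definition graph_dist :: "'a pair_pre_digraph \<Rightarrow> 'a \<Rightarrow> 'a \<Rightarrow> ereal" where
  "graph_dist G u v = wf_digraph.\<mu> (with_proj G) (\<lambda>_. 1) u v"

definition dist_to_set :: "'a pair_pre_digraph \<Rightarrow> 'a \<Rightarrow> 'a set \<Rightarrow> ereal" where
  "dist_to_set G v S = Min (graph_dist G v ` S)"

definition representation :: "'a pair_pre_digraph \<Rightarrow> 'a set list \<Rightarrow> 'a \<Rightarrow> ereal list" where
  "representation G Ss v = map (dist_to_set G v) Ss"

text \<open>
  A partition \<open>{S\<^sub>1, \<dots>, S\<^sub>k}\<close> is given as the list of its \<open>k\<close> distinct parts.  The predicate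
  \<^const>\<open>partition_on\<close> requires the parts to be nonempty.
\<close>

definition resolving_partition :: "'a pair_pre_digraph \<Rightarrow> 'a set list \<Rightarrow> bool" where
  "resolving_partition G Ss \<longleftrightarrow>
     distinct Ss \<and> partition_on (pverts G) (set Ss) \<and>
     (\<forall>u\<in>pverts G. \<forall>v\<in>pverts G. u \<noteq> v \<longrightarrow> representation G Ss u \<noteq> representation G Ss v)"

lemma toeplitz_pair_graph: "pair_graph (toeplitz_graph m W)"
proof
  show "finite (parcs (toeplitz_graph m W))"
    by (rule finite_subset[of _ "{1..m} \<times> {1..m}"]) (auto simp: toeplitz_graph_def)
  show "symmetric (with_proj (toeplitz_graph m W))"
    by (auto simp: symmetric_def sym_def toeplitz_graph_def abs_minus_commute)
qed (auto simp: toeplitz_graph_def)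

lemma toeplitz_adjacent_iff:
  assumes "even n" "n \<ge> 4"
  shows "(i, j) \<in> parcs (toeplitz_graph (2 * n) (W_set n)) \<longleftrightarrow>
    i \<in> {1..2 * n} \<and> j \<in> {1..2 * n} \<and> (odd \<bar>int i - int j\<bar> \<or> \<bar>int i - int j\<bar> = int n)"
proof -
  have W: "(\<exists>t\<in>W_set n. \<bar>int i - int j\<bar> = int t) \<longleftrightarrow> odd \<bar>int i - int j\<bar> \<or> \<bar>int i - int j\<bar> = int n"
    if ij: "i \<in> {1..2 * n}" "j \<in> {1..2 * n}"
  proof -
    define d where "d = nat \<bar>int i - int j\<bar>"
    have d: "\<bar>int i - int j\<bar> = int d" and "d < 2 * n" using ij by (auto simp: d_def)
    have "d \<in> W_set n \<longleftrightarrow> odd d \<or> d = n"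
    proof
      assume "d \<in> W_set n" then show "odd d \<or> d = n" by (auto simp: W_set_def)
    next
      assume "odd d \<or> d = n"
      then show "d \<in> W_set n"
      proof
        assume "odd d"
        then obtain q where "d = 2 * q + 1" by (rule oddE)
        then have "d = 2 * Suc q - 1" "Suc q \<in> {1..n}" using \<open>d < 2 * n\<close> by auto
        then show ?thesis unfolding W_set_def by blast
      qed (simp add: W_set_def)
    qed
    then show ?thesis unfolding d by auto
  qed
  show ?thesis using W assms by (auto simp: toeplitz_graph_def)
qed

lemma toeplitz_connected:
  assumes "even n" "n \<ge> 4"
  shows "strongly_connected (with_proj (toeplitz_graph (2 * n) (W_set n)))" (is "strongly_connected ?G")
proof -
  interpret pair_graph "toeplitz_graph (2 * n) (W_set n)" by (rule toeplitz_pair_graph)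
  have verts: "pverts (toeplitz_graph (2 * n) (W_set n)) = {1..2 * n}"
    by (simp add: toeplitz_graph_def)
  have odd_adj: "u \<rightarrow>\<^bsub>?G\<^esub> v" if "u \<in> {1..2 * n}" "v \<in> {1..2 * n}" "odd (u + v)" for u v
  proof -
    have "odd \<bar>int u - int v\<bar>" using that(3) by simp
    then show ?thesis using that toeplitz_adjacent_iff[OF assms, of u v] by simp
  qed
  show ?thesis
  proof (rule strongly_connectedI)
    fix u v assume uv: "u \<in> verts ?G" "v \<in> verts ?G"
    then have uv': "u \<in> {1..2 * n}" "v \<in> {1..2 * n}" by (simp_all add: verts)
    show "u \<rightarrow>\<^sup>*\<^bsub>?G\<^esub> v"
    proof (cases "odd (u + v)")
      case True then show ?thesis using odd_adj uv' by (intro reachable_adjI) auto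
    next
      case False
      define w where "w = (if odd u then 2 else 1 :: nat)"
      have "w \<in> {1..2 * n}" "odd (u + w)" "odd (w + v)"
        using False assms by (auto simp: w_def)
      then have "u \<rightarrow>\<^bsub>?G\<^esub> w" "w \<rightarrow>\<^bsub>?G\<^esub> v" using odd_adj uv' by blast+
      then show ?thesis using reachable_trans[of u w v] reachable_adjI[of u w] reachable_adjI[of w v] by simp
    qed
  qed (use assms in \<open>simp add: verts\<close>)
qed

end

theory Submission
  imports Defs
begin

text \<open>
  Vertices of opposite parity are adjacent, and a vertex \<open>x\<^sub>i\<close> has exactly one neighbour of its own
  parity, its mate \<open>x\<^sub>i\<^sub>\<plusminus>\<^sub>n\<close>; all other distances are 2.  So within one parity class a vertex is
  represented by its own part together with the part of its mate, the latter being visible only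
  if it is another part consisting of vertices of that parity.  If the partition has \<open>a\<close> parts of
  that parity only, \<open>b\<close> of the other parity only and \<open>c\<close> mixed ones, then the \<open>n\<close> vertices of the
  class have at most \<open>a\<^sup>2 + c (a + 1)\<close> representations.  Taking the parity with \<open>a \<le> b\<close>, so that
  \<open>c \<le> k - 2 a\<close>, completing the square gives \<open>n \<le> k\<^sup>2 / 4 + 1\<close>.
\<close>

text \<open>With unit costs the cost of a walk is its length, so the infimum defining the distance
  is attained at any shortest walk \<open>p\<close>.\<close>

lemma graph_dist_eqI:
  assumes "wf_digraph (with_proj G)" and "pre_digraph.awalk (with_proj G) u p v"
    and "\<And>q. pre_digraph.awalk (with_proj G) u q v \<Longrightarrow> length p \<le> length q"
  shows "graph_dist G u v = ereal (length p)"
proof -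
  interpret wf_digraph "with_proj G" by fact
  have cost: "awalk_cost (\<lambda>_. 1) q = real (length q)" for q :: "('a \<times> 'a) list"
    by (simp add: awalk_cost_def sum_list_triv)
  show ?thesis
    unfolding graph_dist_def \<mu>_def cost
    using assms(2,3) by (intro antisym INF_greatest INF_lower2[of p]) auto
qed

lemma graph_dist_self:
  assumes "pair_graph G" and "u \<in> pverts G"
  shows "graph_dist G u u = 0"
proof -
  interpret pair_graph G by fact
  show ?thesis
    using graph_dist_eqI[of G u "[]" u] assms(2) by (simp add: awalk_Nil_iff wf_digraph_axioms zero_ereal_def)
qed

lemma graph_dist_adjacent:
  assumes "pair_graph G" and "(u, v) \<in> parcs G"
  shows "graph_dist G u v = 1"
proof -
  interpret pair_graph G by fact
  have "u \<noteq> v" using assms(2) no_loops' by blast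
  have "awalk u [(u, v)] v" using assms(2) by (auto simp: awalk_simps dest: in_arcsD2)
  moreover have "1 \<le> length q" if "awalk u q v" for q
    using that \<open>u \<noteq> v\<close> by (cases q) (auto simp: awalk_simps)
  ultimately show ?thesis
    using graph_dist_eqI[of G u "[(u, v)]" v] by (simp add: wf_digraph_axioms one_ereal_def)
qed

lemma graph_dist_two:
  assumes "pair_graph G" and "u \<noteq> v" and "(u, v) \<notin> parcs G"
    and "(u, w) \<in> parcs G" and "(w, v) \<in> parcs G"
  shows "graph_dist G u v = 2"
proof -
  interpret pair_graph G by fact
  have "awalk u [(u, w), (w, v)] v" using assms(4,5) by (auto simp: awalk_simps dest: in_arcsD2)
  moreover have "length [(u, w), (w, v)] \<le> length q" if "awalk u q v" for q
  \<comment> \<open>This rule serves only to split \<open>q\<close> into the empty list, a singleton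
    and a list of length at least two. The first would force \<open>u = v\<close>, the second an arc
    from \<open>u\<close> to \<open>v\<close>.\<close>
  proof (cases q rule: remdups_adj.cases)
    case (2 e)
    then show ?thesis using that assms(3) by (cases e) (auto simp: awalk_simps)
  qed (use that assms(2) in \<open>auto simp: awalk_simps\<close>)
  ultimately have "graph_dist G u v = ereal (length [(u, w), (w, v)])"
    by (rule graph_dist_eqI[OF wf_digraph_axioms])
  then show ?thesis by simp
qed

definition mate :: "nat \<Rightarrow> nat \<Rightarrow> nat" where
  "mate n i = (if i \<le> n then i + n else i - n)"

lemma mate_in_vertices: "i \<in> {1..2 * n} \<Longrightarrow> mate n i \<in> {1..2 * n}"
  by (auto simp: mate_def)

lemma even_mate_iff: "even n \<Longrightarrow> even (mate n i) \<longleftrightarrow> even i"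
  by (auto simp: mate_def)

lemma diff_eq_iff_mate:
  assumes "i \<in> {1..2 * n}" and "j \<in> {1..2 * n}"
  shows "\<bar>int i - int j\<bar> = int n \<longleftrightarrow> j = mate n i"
  using assms by (auto simp: mate_def)

lemma toeplitz_dist:
  assumes "even n" and "n \<ge> 4" and uv: "u \<in> {1..2 * n}" "v \<in> {1..2 * n}"
  shows "graph_dist (toeplitz_graph (2 * n) (W_set n)) u v =
    (if u = v then 0 else if odd (u + v) \<or> v = mate n u then 1 else 2)"
proof -
  let ?G = "toeplitz_graph (2 * n) (W_set n)"
  have verts: "pverts ?G = {1..2 * n}" by (simp add: toeplitz_graph_def)
  have adj: "(i, j) \<in> parcs ?G \<longleftrightarrow> odd (i + j) \<or> j = mate n i"
    if "i \<in> {1..2 * n}" "j \<in> {1..2 * n}" for i j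
    using that diff_eq_iff_mate[OF that] toeplitz_adjacent_iff[OF assms(1,2), of i j] by auto
  consider "u = v" | "u \<noteq> v" "odd (u + v) \<or> v = mate n u"
    | "u \<noteq> v" "even (u + v)" "v \<noteq> mate n u" by blast
  then show ?thesis
  proof cases
    case 1
    then show ?thesis using graph_dist_self[OF toeplitz_pair_graph] verts uv by simp
  next
    case 2
    then show ?thesis using graph_dist_adjacent[OF toeplitz_pair_graph] adj uv by simp
  next
    case 3
    \<comment> \<open>\<open>w\<close> has the parity opposite to that of \<open>u\<close> and
      \<open>v\<close>, hence is a common neighbour.\<close>
    define w where "w = (if odd u then 2 else 1 :: nat)"
    have "w \<in> {1..2 * n}" "odd (u + w)" "odd (w + v)"
      using 3 assms by (auto simp: w_def)
    then have "graph_dist ?G u v = 2"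
      using 3 adj uv by (intro graph_dist_two[OF toeplitz_pair_graph, where w = w]) auto
    with 3 show ?thesis by simp
  qed
qed

text \<open>Only a set \<open>S\<close> of vertices of the parity of \<open>u\<close> can be at
  distance 2. Any other nonempty \<open>S\<close> is at distance 0 or 1, which tells no more than
  whether \<open>u\<close> lies in it.\<close>

lemma toeplitz_dist_to_set:
  assumes n: "even n" "n \<ge> 4" and u: "u \<in> {1..2 * n}" and S: "S \<subseteq> {1..2 * n}" "S \<noteq> {}"
  shows "dist_to_set (toeplitz_graph (2 * n) (W_set n)) u S =
    (if u \<in> S then 0 else if (\<exists>v\<in>S. odd (u + v)) \<or> mate n u \<in> S then 1 else 2)"
proof -
  let ?d = "graph_dist (toeplitz_graph (2 * n) (W_set n)) u"
  have d: "?d v = (if u = v then 0 else if odd (u + v) \<or> v = mate n u then 1 else 2)"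
    if "v \<in> S" for v
    using that S u by (intro toeplitz_dist[OF n]) auto
  have fin: "finite (?d ` S)" using S(1) finite_subset by blast
  consider "u \<in> S" | "u \<notin> S" "(\<exists>v\<in>S. odd (u + v)) \<or> mate n u \<in> S"
    | "u \<notin> S" "\<forall>v\<in>S. even (u + v)" "mate n u \<notin> S" by blast
  then show ?thesis
  proof cases
    case 1
    have "Min (?d ` S) = 0"
    proof (rule Min_eqI[OF fin])
      show "0 \<in> ?d ` S" using 1 d[of u] by (auto intro: rev_image_eqI)
    qed (auto simp: d)
    with 1 show ?thesis by (simp add: dist_to_set_def)
  next
    case 2
    then obtain v where "v \<in> S" "odd (u + v) \<or> v = mate n u" by blast
    have "Min (?d ` S) = 1"
    proof (rule Min_eqI[OF fin])
      show "1 \<in> ?d ` S"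
        using 2(1) \<open>v \<in> S\<close> \<open>odd (u + v) \<or> v = mate n u\<close> d[of v]
        by (intro rev_image_eqI[of v]) (auto simp del: odd_add even_add)
    qed (use 2 in \<open>auto simp: d\<close>)
    with 2 show ?thesis by (simp add: dist_to_set_def)
  next
    case 3
    have "?d ` S = {2}" using 3 S(2) by (force simp: d image_iff)
    with 3 show ?thesis by (auto simp: dist_to_set_def)
  qed
qed

text \<open>The parity is a Boolean, \<open>True\<close> for even, so that one counting argument
  serves both parity classes.\<close>

definition pure_parts :: "bool \<Rightarrow> nat set set \<Rightarrow> nat set set" where
  "pure_parts e P = {S \<in> P. \<forall>u\<in>S. even u = e}"

lemma card_parity_class: "card {u \<in> {1..2 * n}. even u = e} = n"
proof (cases e)
  case True
  have "{u \<in> {1..2 * n}. even u} = (\<lambda>i. 2 * i) ` {1..n}" by (auto elim!: evenE)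
  then show ?thesis using True by (simp add: card_image inj_on_def)
next
  case False
  have "{u \<in> {1..2 * n}. odd u} = (\<lambda>i. 2 * i + 1) ` {0..<n}" by (auto elim!: oddE)
  then show ?thesis using False by (simp add: card_image inj_on_def)
qed

lemma parity_class_bound:
  fixes n :: nat and Ss :: "nat set list" and e :: bool
  assumes n: "even n" "n \<ge> 4"
    and res: "resolving_partition (toeplitz_graph (2 * n) (W_set n)) Ss"
  defines "P \<equiv> set Ss"
  defines "a \<equiv> card (pure_parts e P)"
  shows "n \<le> a\<^sup>2 + card (P - (pure_parts e P \<union> pure_parts (\<not> e) P)) * (a + 1)"
proof -
  let ?G = "toeplitz_graph (2 * n) (W_set n)"
  let ?V = "{1..2 * n}"
  define A where "A = pure_parts e P"
  define C where "C = P - (pure_parts e P \<union> pure_parts (\<not> e) P)"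
  define X where "X = {u \<in> ?V. even u = e}"
  have verts: "pverts ?G = ?V" by (simp add: toeplitz_graph_def)
  have part: "partition_on ?V P"
    using res by (simp add: resolving_partition_def verts P_def)
  have sep: "u = v"
    if uv: "u \<in> ?V" "v \<in> ?V" and eq: "\<And>S. S \<in> P \<Longrightarrow> dist_to_set ?G u S = dist_to_set ?G v S"
    for u v
  proof -
    have "representation ?G Ss u = representation ?G Ss v"
      using eq by (simp add: representation_def P_def)
    with res uv show ?thesis unfolding resolving_partition_def verts by blast
  qed
  have "\<forall>u\<in>?V. \<exists>S\<in>P. u \<in> S" using partition_onD1[OF part] by blast
  then obtain f where f: "\<And>u. u \<in> ?V \<Longrightarrow> f u \<in> P \<and> u \<in> f u" by metis
  have f_eq: "S = f u" if "S \<in> P" "u \<in> S" "u \<in> ?V" for S u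
    using that f disjointD[OF partition_onD2[OF part], of S "f u"] by blast
  have finite: "finite A" "finite C" by (simp_all add: A_def C_def P_def pure_parts_def)
  \<comment> \<open>\<open>g u\<close> encodes the representation of \<open>u\<close>. The default
    \<open>f u\<close> in the second component also arises when the mate shares a part with
    \<open>u\<close>. This merging is harmless: in either case no part of \<open>A\<close> other
    than \<open>f u\<close> is at distance 1. It also keeps the second component in
    \<open>insert (f u) A\<close>, which leaves \<open>a\<close> choices if \<open>f u\<close> is in
    \<open>A\<close> and \<open>a + 1\<close> if it is in \<open>C\<close>.\<close>
  define g where "g u = (f u, if f (mate n u) \<in> A then f (mate n u) else f u)" for u
  have "inj_on g X"
  proof (rule inj_onI)
    fix u v assume uv: "u \<in> X" "v \<in> X" and "g u = g v"
    then have same: "f u = f v" "(if f (mate n u) \<in> A then f (mate n u) else f u) =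
        (if f (mate n v) \<in> A then f (mate n v) else f v)" by (simp_all add: g_def)
    have V: "u \<in> ?V" "v \<in> ?V" and parity: "even u = e" "even v = e" using uv by (auto simp: X_def)
    show "u = v"
    proof (rule sep[OF V])
      fix S assume "S \<in> P"
      then have S: "S \<subseteq> ?V" "S \<noteq> {}" using partition_onD1[OF part] partition_onD3[OF part] by auto
      have mem: "w \<in> S \<longleftrightarrow> S = f w" if "w \<in> ?V" for w
        using f_eq[OF \<open>S \<in> P\<close> _ that] f[OF that] by blast
      \<comment> \<open>Mates matter only for these \<open>S\<close>: every part outside
        \<open>A\<close> contains a vertex of the other parity, adjacent to both \<open>u\<close>
        and \<open>v\<close>.\<close>
      have "mate n u \<in> S \<longleftrightarrow> mate n v \<in> S" if "S \<in> A" "S \<noteq> f u"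
        using that same V mem[OF mate_in_vertices] by (auto split: if_splits)
      moreover have "S \<in> A \<longleftrightarrow> \<not> (\<exists>w\<in>S. odd (u + w))" "S \<in> A \<longleftrightarrow> \<not> (\<exists>w\<in>S. odd (v + w))"
        using parity \<open>S \<in> P\<close> by (auto simp: A_def pure_parts_def)
      ultimately show "dist_to_set ?G u S = dist_to_set ?G v S"
        using mem[OF V(1)] mem[OF V(2)] same(1)
        unfolding toeplitz_dist_to_set[OF n V(1) S] toeplitz_dist_to_set[OF n V(2) S] by auto
    qed
  qed
  moreover have "g ` X \<subseteq> (SIGMA S:A \<union> C. insert S A)"
  proof -
    \<comment> \<open>A part containing a vertex of parity \<open>e\<close> is not pure of the other
      parity.\<close>
    have "f u \<in> A \<union> C" if "u \<in> X" for u
      using that f[of u] by (auto simp: X_def A_def C_def pure_parts_def)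
    then show ?thesis by (auto simp: g_def split: if_splits)
  qed
  ultimately have "card X \<le> card (SIGMA S:A \<union> C. insert S A)"
    using finite by (intro card_inj_on_le) auto
  also have "\<dots> = (\<Sum>S\<in>A. card (insert S A)) + (\<Sum>S\<in>C. card (insert S A))"
    using finite by (simp add: card_SigmaI) (rule sum.union_disjoint, auto simp: A_def C_def)
  also have "(\<Sum>S\<in>A. card (insert S A)) = a\<^sup>2"
    by (simp add: insert_absorb a_def A_def power2_eq_square)
  also have "(\<Sum>S\<in>C. card (insert S A)) = (\<Sum>S\<in>C. a + 1)"
    using finite by (intro sum.cong) (auto simp: a_def A_def C_def)
  also have "\<dots> = card C * (a + 1)" by simp
  finally show ?thesis unfolding X_def card_parity_class C_def .
qed

lemma quadratic_count_bound:
  fixes a b c n :: int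
  assumes "n \<le> a\<^sup>2 + c * (a + 1)" and "0 \<le> a" and "a \<le> b"
  shows "4 * (n - 1) \<le> (a + b + c)\<^sup>2"
proof -
  define k where "k = a + b + c"
  have "c * (a + 1) \<le> (k - 2 * a) * (a + 1)"
    using assms(2,3) by (intro mult_right_mono) (auto simp: k_def)
  with assms(1) have "n \<le> a\<^sup>2 + (k - 2 * a) * (a + 1)" by linarith
  \<comment> \<open>Completing the square: \<open>a\<^sup>2 + (k - 2 * a) * (a + 1)\<close> equals
    k^2/4 + 1 - (a - (k - 2)/2)^2. The factor 4 keeps everything integral.\<close>
  then have "4 * (n - 1) + (2 * a - (k - 2))\<^sup>2 \<le> k\<^sup>2"
    by (simp add: power2_eq_square algebra_simps)
  then show ?thesis using zero_le_power2[of "2 * a - (k - 2)"] unfolding k_def by linarith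
qed

theorem theorem3p11:
  fixes n :: nat and Ss :: "nat set list"
  assumes "n \<ge> 4" and "even n"
    and "resolving_partition (toeplitz_graph (2 * n) (W_set n)) Ss"
  shows "int (length Ss) \<ge> \<lceil>2 * sqrt (real n - 1)\<rceil>"
proof -
  define A where "A e = pure_parts e (set Ss)" for e
  define a where "a e = card (A e)" for e
  define c where "c = card (set Ss - (A True \<union> A False))"
  \<comment> \<open>An empty part would be pure of both parities and be counted twice.\<close>
  have "{} \<notin> set Ss"
    using assms(3) partition_onD3 by (auto simp: resolving_partition_def)
  then have "A True \<inter> A False = {}" by (auto simp: A_def pure_parts_def)
  moreover have sub: "A e \<subseteq> set Ss" for e by (auto simp: A_def pure_parts_def)
  ultimately have "card (set Ss) = a True + a False + c"
    using card_Un_disjoint[of "A True" "A False"] card_Diff_subset[of "A True \<union> A False" "set Ss"]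
      card_mono[of "set Ss" "A True \<union> A False"] finite_subset[OF sub]
    by (simp add: a_def c_def)
  moreover have "length Ss = card (set Ss)"
    using assms(3) by (simp add: resolving_partition_def distinct_card)
  ultimately have k: "int (length Ss) = int (a True) + int (a False) + int c" by simp
  have bound_nat: "n \<le> (a e)\<^sup>2 + c * (a e + 1)" for e
    using parity_class_bound[OF assms(2,1,3), of e]
    by (cases e) (simp_all add: a_def A_def c_def Un_commute)
  have bound: "int n \<le> (int (a e))\<^sup>2 + int c * (int (a e) + 1)" for e
    using of_nat_mono[OF bound_nat[of e], where 'a = int] by (simp add: algebra_simps)
  have "4 * (int n - 1) \<le> (int (length Ss))\<^sup>2"
  \<comment> \<open>The count is applied to the parity class with at most as many pure parts as the
    other, as \<open>quadratic_count_bound\<close> demands.\<close>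
  proof (cases "a True \<le> a False")
    case True
    then show ?thesis using quadratic_count_bound[OF bound[of True], of "int (a False)"] by (simp add: k)
  next
    case False
    then show ?thesis
      using quadratic_count_bound[OF bound[of False], of "int (a True)"] by (simp add: k add.commute)
  qed
  then have "real_of_int (4 * (int n - 1)) \<le> real_of_int ((int (length Ss))\<^sup>2)"
    by (rule of_int_le_iff[THEN iffD2])
  then have "4 * (real n - 1) \<le> (real (length Ss))\<^sup>2" by simp
  then have "sqrt (4 * (real n - 1)) \<le> real (length Ss)" by (intro real_le_lsqrt) auto
  then have "2 * sqrt (real n - 1) \<le> real (length Ss)"
    by (simp only: real_sqrt_mult real_sqrt_four)
  then show ?thesis by (simp add: ceiling_le_iff)
qed

end
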